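(* Let $H\in\mathbb{R}^{n\times n}$ be symmetric, $g\in\mathbb{R}^n$ with $g\neq 0$, $M>0$, and let $s^\star$ be a global minimizer over $\mathbb{R}^n$ of the cubic model $m(s)=\langle g,s\rangle+\tfrac12\langle Hs,s\rangle+\tfrac{M}{6}\|s\|^3$, with $r^\star=\|s^\star\|$. Then $$m(s^\star)\le-\tfrac{M}{12}(r^\star)^3 .$$ If in addition $g=\nabla f(x)$ and $H=\nabla^2 f(x)$ for a twice-differentiable $f:\mathbb{R}^n\to\mathbb{R}$ satisfying $\|\nabla^2 f(y)-\nabla^2 f(z)\|\le L_H\|y-z\|$ for all $y,z$, and $M\ge L_H$, then $$f(x+s^\star)\le f(x)-\tfrac{M}{12}(r^\star)^3 .$$
   Context: Norms are Euclidean for vectors and spectral for matrices. *)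

theory Defs
  imports "HOL-Analysis.Analysis"
begin

definition cubic_model :: "real^'n \<Rightarrow> real^'n^'n \<Rightarrow> real \<Rightarrow> real^'n \<Rightarrow> real" where
  "cubic_model g H M s = g \<bullet> s + 1/2 * ((H *v s) \<bullet> s) + M/6 * norm s ^ 3"

(* The spectral norm, i.e. the operator norm induced by the Euclidean norm.  The library's
   norm on the type of matrices is the Frobenius norm. *)
definition spectral_norm :: "real^'n^'m \<Rightarrow> real" where
  "spectral_norm A = onorm ((*v) A)"

(* Meaningful only where f is differentiable; there the vector is unique. *)
definition gradient :: "(real^'n \<Rightarrow> real) \<Rightarrow> real^'n \<Rightarrow> real^'n" where
  "gradient f x = (THE v. GDERIV f x :> v)"

definition hessian :: "(real^'n \<Rightarrow> real) \<Rightarrow> real^'n \<Rightarrow> real^'n^'n" where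
  "hessian f x = matrix (frechet_derivative (gradient f) (at x))"

(* No continuity of the Hessian is required. *)
definition twice_differentiable :: "(real^'n \<Rightarrow> real) \<Rightarrow> bool" where
  "twice_differentiable f \<longleftrightarrow>
     (\<forall>x. f differentiable (at x)) \<and> (\<forall>x. gradient f differentiable (at x))"

lemma gradient_eqI:
  assumes "GDERIV f x :> v"
  shows "gradient f x = v"
  unfolding gradient_def
proof (rule the_equality)
  show "w = v" if "GDERIV f x :> w" for w
  proof -
    have "(\<lambda>h. h \<bullet> w) = (\<lambda>h. h \<bullet> v)"
      using that assms unfolding gderiv_def by (rule has_derivative_unique)
    then have "\<forall>h. h \<bullet> w = h \<bullet> v"
      by (rule fun_cong[THEN allI])
    then show ?thesis
      by (simp only: vector_eq_ldot)
  qed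
qed (fact assms)

lemma gradient_GDERIV:
  fixes f :: "real^'n \<Rightarrow> real"
  assumes "f differentiable (at x)"
  shows "GDERIV f x :> gradient f x"
proof -
  obtain D where D: "(f has_derivative D) (at x)"
    using assms unfolding differentiable_def by blast
  then have "linear D"
    by (rule has_derivative_linear)
  then have "D h = h \<bullet> adjoint D 1" for h
    using adjoint_works[of D h 1] by simp
  then have "D = (\<lambda>h. h \<bullet> adjoint D 1)"
    by (rule ext)
  with D have G: "GDERIV f x :> adjoint D 1"
    unfolding gderiv_def by (rule subst[rotated])
  show ?thesis
    unfolding gradient_eqI[OF G] by (rule G)
qed

lemma hessian_has_derivative:
  assumes "twice_differentiable f"
  shows "(gradient f has_derivative (\<lambda>h. hessian f x *v h)) (at x)"
proof -
  have D: "(gradient f has_derivative frechet_derivative (gradient f) (at x)) (at x)"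
    using assms unfolding twice_differentiable_def by (simp add: frechet_derivative_works)
  then have "linear (frechet_derivative (gradient f) (at x))"
    by (rule has_derivative_linear)
  then show ?thesis
    using D by (simp add: hessian_def matrix_works)
qed

end

theory Submission
  imports Defs
begin

text \<open>
  Restrict the model to the line through the minimizer: \<open>m(t s) = a t + b t^2 / 2 + c |t|^3 / 6\<close>
  with \<open>c = M r^3\<close>. Stationarity at \<open>t = 1\<close> gives \<open>a + b + c / 2 = 0\<close>, hence
  \<open>m(s) = a / 2 - c / 12\<close>, and comparison with \<open>t = -1\<close> gives \<open>a \<le> 0\<close>. For the second claim, the
  Lipschitz Hessian makes \<open>f(x) + m(s)\<close> an upper bound of \<open>f(x + s)\<close>.
\<close>

text \<open>The absolute value keeps the formula valid for negative \<open>t\<close>, where the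
  comparison with \<open>-s\<close> takes place.\<close>

lemma cubic_model_scaleR:
  "cubic_model g H M (t *\<^sub>R s) =
     t * (g \<bullet> s) + t^2 / 2 * ((H *v s) \<bullet> s) + \<bar>t\<bar>^3 * (M / 6 * norm s ^ 3)"
  by (simp add: cubic_model_def matrix_vector_mult_scaleR power2_eq_square power_mult_distrib
      mult_ac)

lemma cubic_model_minimizer_stationary:
  assumes "\<And>u. cubic_model g H M s \<le> cubic_model g H M u"
  shows "g \<bullet> s + (H *v s) \<bullet> s + M / 2 * norm s ^ 3 = 0"
proof -
  \<comment> \<open>Here \<open>t^3\<close> replaces the cube of the absolute value:
    \<open>\<phi>\<close> is a polynomial, and it agrees with the model at
    \<open>t *\<^sub>R s\<close> for nonnegative \<open>t\<close>. Radius 1 around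
    \<open>t = 1\<close> stays in that range, so 1 is a local minimum of
    \<open>\<phi>\<close>.\<close>
  define \<phi> where "\<phi> t = t * (g \<bullet> s) + t^2 / 2 * ((H *v s) \<bullet> s) + t^3 * (M / 6 * norm s ^ 3)"
    for t :: real
  have "(\<phi> has_real_derivative g \<bullet> s + (H *v s) \<bullet> s + M / 2 * norm s ^ 3) (at 1)"
    unfolding \<phi>_def by (auto intro!: derivative_eq_intros)
  moreover have "\<phi> 1 \<le> \<phi> t" if "\<bar>1 - t\<bar> < 1" for t
  proof -
    have "cubic_model g H M (1 *\<^sub>R s) \<le> cubic_model g H M (t *\<^sub>R s)"
      using assms by simp
    with that show ?thesis
      unfolding cubic_model_scaleR \<phi>_def by simp
  qed
  ultimately show ?thesis
    using DERIV_local_min[of \<phi> _ 1 1] by simp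
qed

lemma cubic_model_minimizer_le:
  assumes min: "\<And>u. cubic_model g H M s \<le> cubic_model g H M u"
  shows "cubic_model g H M s \<le> - (M / 12) * norm s ^ 3"
proof -
  have "cubic_model g H M s \<le> cubic_model g H M ((- 1) *\<^sub>R s)"
    by (rule min)
  \<comment> \<open>The quadratic and cubic terms are even in \<open>s\<close> and cancel, leaving
    twice the linear term.\<close>
  then have "g \<bullet> s \<le> 0"
    unfolding cubic_model_scaleR by (simp add: cubic_model_def)
  \<comment> \<open>Stationarity eliminates the quadratic term; the cubic coefficient becomes
    \<open>M/6 - M/4 = - M/12\<close>.\<close>
  with cubic_model_minimizer_stationary[OF min] show ?thesis
    by (simp add: cubic_model_def)
qed

lemma inner_matrix_vector_le_spectral_norm:
  fixes A :: "real^'n^'n"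
  shows "(A *v s) \<bullet> s \<le> spectral_norm A * norm s ^ 2"
proof -
  have "(A *v s) \<bullet> s \<le> norm (A *v s) * norm s"
    by (rule norm_cauchy_schwarz)
  also have "\<dots> \<le> spectral_norm A * norm s * norm s"
    unfolding spectral_norm_def
    by (intro mult_right_mono onorm matrix_vector_mul_bounded_linear norm_ge_zero)
  finally show ?thesis
    by (simp add: power2_eq_square mult.assoc)
qed

text \<open>Two monotonicity arguments along the segment from \<open>x\<close> to
  \<open>x + s\<close> take the place of an integral remainder: \<open>\<psi>'\<close> has
  nonpositive derivative and vanishes at 0, so it is nonpositive for \<open>t \<ge> 0\<close>, and
  \<open>\<psi>\<close> does not increase from 0 to 1.\<close>

lemma lipschitz_hessian_upper_bound:
  fixes f :: "real^'n \<Rightarrow> real"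
  assumes f: "twice_differentiable f"
    and lip: "\<And>y z. spectral_norm (hessian f y - hessian f z) \<le> L * norm (y - z)"
  shows "f (x + s) \<le> f x + cubic_model (gradient f x) (hessian f x) L s"
proof -
  define H where "H y = hessian f y" for y
  define p where "p t = x + t *\<^sub>R s" for t :: real
  \<comment> \<open>The term \<open>f x\<close> is not subtracted, so \<open>\<psi> 0 = f x\<close>
    and the claim is \<open>\<psi> 1 \<le> \<psi> 0\<close>.\<close>
  define \<psi> where "\<psi> t = f (p t) - t * (gradient f x \<bullet> s) - t^2 / 2 * ((H x *v s) \<bullet> s)
    - t^3 * (L / 6 * norm s ^ 3)" for t :: real
  define \<psi>' where "\<psi>' t = gradient f (p t) \<bullet> s - gradient f x \<bullet> s - t * ((H x *v s) \<bullet> s)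
    - t^2 * (L / 2 * norm s ^ 3)" for t :: real
  have p: "(p has_derivative (\<lambda>h. h *\<^sub>R s)) (at t)" for t
    unfolding p_def by (auto intro!: derivative_eq_intros)
  have fp: "((\<lambda>t. f (p t)) has_real_derivative gradient f (p t) \<bullet> s) (at t)" for t
  proof -
    have "GDERIV f (p t) :> gradient f (p t)"
      using f gradient_GDERIV unfolding twice_differentiable_def by blast
    from has_derivative_compose[OF p this[unfolded gderiv_def]] show ?thesis
      unfolding has_field_derivative_def
      by (rule has_derivative_eq_rhs) (simp add: fun_eq_iff inner_commute)
  qed
  have gp: "((\<lambda>t. gradient f (p t) \<bullet> s) has_real_derivative (H (p t) *v s) \<bullet> s) (at t)" for t
  proof -
    from has_derivative_inner_left[OF
        has_derivative_compose[OF p hessian_has_derivative[OF f]], of s]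
    show ?thesis
      unfolding has_field_derivative_def
      by (rule has_derivative_eq_rhs) (simp add: fun_eq_iff H_def matrix_vector_mult_scaleR)
  qed
  have d1: "(\<psi> has_real_derivative \<psi>' t) (at t)" for t
    unfolding \<psi>_def \<psi>'_def by (auto intro!: derivative_eq_intros fp)
  have d2: "(\<psi>' has_real_derivative ((H (p t) - H x) *v s) \<bullet> s - t * (L * norm s ^ 3)) (at t)" for t
    unfolding \<psi>'_def
    by (auto intro!: derivative_eq_intros gp simp: matrix_vector_mult_diff_rdistrib inner_diff_left)
  \<comment> \<open>For \<open>t \<ge> 0\<close> the distance from \<open>p t\<close> to
    \<open>x\<close> is \<open>t * norm s\<close>, so the Lipschitz bound yields exactly the
    subtracted term; this fixes the coefficient \<open>L / 6\<close> in
    \<open>\<psi>\<close>.\<close>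
  have d2_le: "((H (p t) - H x) *v s) \<bullet> s - t * (L * norm s ^ 3) \<le> 0" if "0 \<le> t" for t
  proof -
    have "((H (p t) - H x) *v s) \<bullet> s \<le> spectral_norm (H (p t) - H x) * norm s ^ 2"
      by (rule inner_matrix_vector_le_spectral_norm)
    also have "\<dots> \<le> L * norm (p t - x) * norm s ^ 2"
      unfolding H_def by (intro mult_right_mono lip) simp
    finally show ?thesis
      using that by (simp add: p_def power3_eq_cube power2_eq_square algebra_simps)
  qed
  have "\<psi>' t \<le> \<psi>' 0" if "0 \<le> t" for t
    using that by (rule DERIV_nonpos_imp_nonincreasing) (use d2 d2_le in blast)
  moreover have "\<psi>' 0 = 0"
    by (simp add: \<psi>'_def p_def)
  ultimately have "\<psi>' t \<le> 0" if "0 \<le> t" for t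
    using that by simp
  then have "\<psi> 1 \<le> \<psi> 0"
    by (intro DERIV_nonpos_imp_nonincreasing[OF zero_le_one]) (use d1 in blast)
  then show ?thesis
    by (simp add: \<psi>_def p_def H_def cubic_model_def)
qed

lemma cubic_model_mono:
  assumes "L \<le> M"
  shows "cubic_model g H L s \<le> cubic_model g H M s"
  unfolding cubic_model_def using assms by (simp add: mult_right_mono)

theorem lemma3p8:
  fixes H :: "real^'n^'n" and g s_star :: "real^'n" and M r_star :: real
  assumes "transpose H = H"
    and "g \<noteq> 0"
    and "M > 0"
    and "\<forall>s. cubic_model g H M s_star \<le> cubic_model g H M s"
    and "r_star = norm s_star"
  shows "cubic_model g H M s_star \<le> - (M / 12) * r_star ^ 3 \<and>
    (\<forall>(f :: real^'n \<Rightarrow> real) (x :: real^'n) (L_H :: real).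
       twice_differentiable f \<and> g = gradient f x \<and> H = hessian f x \<and>
       (\<forall>y z. spectral_norm (hessian f y - hessian f z) \<le> L_H * norm (y - z)) \<and>
       M \<ge> L_H
       \<longrightarrow> f (x + s_star) \<le> f x - M / 12 * r_star ^ 3)"
proof (intro conjI allI impI)
  show model: "cubic_model g H M s_star \<le> - (M / 12) * r_star ^ 3"
    using cubic_model_minimizer_le assms by blast
  fix f :: "real^'n \<Rightarrow> real" and x :: "real^'n" and L_H :: real
  assume "twice_differentiable f \<and> g = gradient f x \<and> H = hessian f x \<and>
    (\<forall>y z. spectral_norm (hessian f y - hessian f z) \<le> L_H * norm (y - z)) \<and> M \<ge> L_H"
  \<comment> \<open>The Taylor bound holds with constant \<open>L_H\<close>, while
    \<open>s_star\<close> minimizes the model with constant \<open>M\<close>; monotonicity in the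
    constant links the two.\<close>
  then have "f (x + s_star) \<le> f x + cubic_model g H L_H s_star"
    and "cubic_model g H L_H s_star \<le> cubic_model g H M s_star"
    using lipschitz_hessian_upper_bound cubic_model_mono by blast+
  with model show "f (x + s_star) \<le> f x - M / 12 * r_star ^ 3"
    by simp
qed

end
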